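(* Let $\gamma\in(0,1)$, $C>0$, and let $(H_x)_{x\in\mathbb{Z}}$ be i.i.d. $[0,\infty)$-valued random variables on a probability space $(\Omega,\mathcal{G},\mathbf{P})$ with $\lim_{z\to\infty} z^{\gamma}\,\mathbf{P}(H_0>z)=C$. Then for $\mathbf{P}$-almost every $\omega\in\Omega$, the graph $\mathrm{Comb}(\mathbb{Z},H^\omega)$ has the finite triple collision property.
   Context: For a profile $H=(H_x)_{x\in\mathbb{Z}}\in[0,\infty)^{\mathbb{Z}}$, the comb graph $\mathrm{Comb}(\mathbb{Z},H)$ has vertex set $V=\{(x,\ell)\in\mathbb{Z}\times\mathbb{N}_0: 0\le \ell\le H_x\}$; its edges are $\{(x,0),(y,0)\}$ for $|x-y|=1$, and $\{(x,\ell),(x,k)\}$ for $x\in\mathbb{Z}$, $|\ell-k|=1$ (both endpoints in $V$). $H^\omega=(H_x(\omega))_{x\in\mathbb{Z}}$. A connected, locally finite graph $G=(V,E)$ has the finite triple collision property if, for some $x\in V$, three independent discrete-time simple random walks $X^1,X^2,X^3$ on $G$, all started at $x$, satisfy that the set $\{n: X^1_n=X^2_n=X^3_n\}$ is almost surely finite. *)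

theory Defs
  imports "HOL-Probability.Probability" "Graph_Theory.Graph_Theory"
begin

text \<open>An undirected simple graph is a symmetric, loop-free set of pairs of vertices, so that every
  edge occurs with both orientations.\<close>

definition neighbours :: "'v pair_pre_digraph \<Rightarrow> 'v \<Rightarrow> 'v set" where
  "neighbours G v = {w. (v, w) \<in> parcs G}"

definition locally_finite_graph :: "'v pair_pre_digraph \<Rightarrow> bool" where
  "locally_finite_graph G \<longleftrightarrow> (\<forall>v\<in>pverts G. finite (neighbours G v))"


text \<open>The conditional law of position \<open>n\<close> given the earlier positions. \<^const>\<open>pmf_of_set\<close> is unspecified
  on the empty set; in a connected graph with at least two vertices there are no isolated vertices.\<close>

definition srw_kernel :: "'v pair_pre_digraph \<Rightarrow> 'v \<Rightarrow> nat \<Rightarrow> (nat \<Rightarrow> 'v) \<Rightarrow> 'v measure" where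
  "srw_kernel G x n X =
     measure_pmf (if n = 0 then return_pmf x else pmf_of_set (neighbours G (X (n - 1))))"

global_interpretation srw: Ionescu_Tulcea "srw_kernel G x" "\<lambda>_. count_space UNIV" for G x
proof (rule Ionescu_Tulcea.intro)
  show "srw_kernel G x i \<in> measurable (PiM {0..<i} (\<lambda>_. count_space UNIV)) (subprob_algebra (count_space UNIV))" for i
  proof (cases i)
    case 0
    then show ?thesis by (simp add: srw_kernel_def[abs_def] measure_pmf_in_subprob_algebra)
  next
    case (Suc n)
    have "(\<lambda>X. X n) \<in> measurable (PiM {0..<i} (\<lambda>_. count_space UNIV)) (count_space (UNIV :: 'a set))"
      by (rule measurable_component_singleton) (simp add: Suc)
    moreover have "(\<lambda>v. measure_pmf (pmf_of_set (neighbours G v)))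
        \<in> measurable (count_space UNIV) (subprob_algebra (count_space UNIV))"
      by (simp add: measure_pmf_in_subprob_algebra)
    ultimately have "(\<lambda>X. measure_pmf (pmf_of_set (neighbours G (X n))))
        \<in> measurable (PiM {0..<i} (\<lambda>_. count_space UNIV)) (subprob_algebra (count_space UNIV))"
      by (rule measurable_compose)
    then show ?thesis by (simp add: srw_kernel_def[abs_def] Suc)
  qed
  show "prob_space (srw_kernel G x i X)" if "X \<in> space (PiM {0..<i} (\<lambda>_. count_space UNIV))" for i X
    by (simp add: srw_kernel_def measure_pmf.prob_space_axioms)
qed

text \<open>The law on path space of the simple random walk on \<open>G\<close> started at \<open>x\<close>, given by the
  Ionescu-Tulcea theorem.\<close>

definition srw_law :: "'v pair_pre_digraph \<Rightarrow> 'v \<Rightarrow> (nat \<Rightarrow> 'v) measure" where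
  "srw_law G x = projective_family.lim UNIV
     (Ionescu_Tulcea.CI (srw_kernel G x) (\<lambda>_. count_space UNIV)) (\<lambda>_. count_space UNIV)"

lemma sets_srw_law [measurable_cong]: "sets (srw_law G x) = sets (PiM UNIV (\<lambda>_. count_space UNIV))"
  by (simp add: srw_law_def)

lemma space_srw_law [simp]: "space (srw_law G x) = UNIV"
  by (simp add: srw_law_def space_PiM)

lemma prob_space_srw_law: "prob_space (srw_law G x)"
proof
  interpret CI: prob_space "srw.CI G x {}"
    by (rule srw.PF.prob_space_P) auto
  have S: "space (srw.CI G x {}) \<in> sets (PiM {} (\<lambda>_. count_space UNIV))"
    by (simp add: srw.CI_def)
  have "emeasure (srw_law G x) (space (srw_law G x)) = emeasure (srw.CI G x {}) (space (srw.CI G x {}))"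
    using srw.lim[OF finite.emptyI S, of G x]
    by (simp add: srw_law_def prod_emb_def space_PiM srw.CI_def restrict_def)
  then show "emeasure (srw_law G x) (space (srw_law G x)) = 1"
    using CI.emeasure_space_1 by simp
qed

lemma emeasure_srw_C_cylinder:
  "emeasure (srw.C G x 0 n (\<lambda>_. undefined))
     {X \<in> space (PiM {0..<n} (\<lambda>_. count_space UNIV)). \<forall>i<n. X i = p i} =
     (\<Prod>i<n. emeasure (srw_kernel G x i p) {p i})"
proof (induction n)
  case 0
  then show ?case by (simp add: PiM_empty)
next
  case (Suc n)
  define S where "S = (\<lambda>n. PiM {0..<n} (\<lambda>_::nat. count_space (UNIV :: 'a set)))"
  define A where "A = (\<lambda>n. {X \<in> space (S n). \<forall>i<n. X i = p i})"
  have A_sets: "A n \<in> sets (S n)" for n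
  proof -
    have "A n = PiE {0..<n} (\<lambda>i. {p i})"
      by (auto simp: A_def S_def space_PiM PiE_iff extensional_def)
    then show ?thesis by (simp add: S_def sets_PiM_I_finite)
  qed
  have u: "(\<lambda>_. undefined) \<in> space (PiM {0..<0} (\<lambda>_::nat. count_space (UNIV :: 'a set)))"
    by (simp add: space_PiM)
  have sp: "space (srw.C G x 0 n (\<lambda>_. undefined)) = space (S n)"
    using srw.space_C[OF u, where m = n] by (simp add: S_def)
  have st: "sets (srw.C G x 0 n (\<lambda>_. undefined)) = sets (S n)"
    using srw.sets_C[OF u, where m = n] by (simp add: S_def)
  have step: "emeasure (srw.eP G x n X) (A (Suc n)) = emeasure (srw_kernel G x n p) {p n} * indicator (A n) X"
    if X: "X \<in> space (S n)" for X
  proof -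
    have "emeasure (srw.eP G x n X) (A (Suc n)) =
        emeasure (srw_kernel G x n X) ((\<lambda>y. X(n := y)) -` A (Suc n) \<inter> space (count_space UNIV))"
      using X A_sets[of "Suc n"] unfolding S_def by (rule srw.emeasure_eP)
    also have "(\<lambda>y. X(n := y)) -` A (Suc n) \<inter> space (count_space UNIV) = (if X \<in> A n then {p n} else {})"
      using X by (auto simp: A_def S_def space_PiM PiE_iff extensional_def less_Suc_eq)
    also have "emeasure (srw_kernel G x n X) \<dots> = emeasure (srw_kernel G x n p) {p n} * indicator (A n) X"
      by (cases n) (auto simp: srw_kernel_def A_def)
    finally show ?thesis .
  qed
  have "emeasure (srw.C G x 0 (Suc n) (\<lambda>_. undefined)) (A (Suc n)) =
      (\<integral>\<^sup>+X. emeasure (srw.eP G x n X) (A (Suc n)) \<partial>srw.C G x 0 n (\<lambda>_. undefined))"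
    using srw.prob_space_C[OF u, of G x n] A_sets[of "Suc n"]
    by (simp, subst emeasure_bind[where N="S (Suc n)"])
       (auto simp: prob_space.not_empty S_def measurable_cong_sets[OF st[unfolded S_def] refl])
  also have "\<dots> = (\<integral>\<^sup>+X. emeasure (srw_kernel G x n p) {p n} * indicator (A n) X \<partial>srw.C G x 0 n (\<lambda>_. undefined))"
    by (intro nn_integral_cong step) (simp add: sp)
  also have "\<dots> = emeasure (srw_kernel G x n p) {p n} * emeasure (srw.C G x 0 n (\<lambda>_. undefined)) (A n)"
    using A_sets[of n] by (intro nn_integral_cmult_indicator) (simp add: st)
  finally show ?case
    using Suc.IH by (simp add: A_def S_def mult.commute)
qed

lemma emeasure_srw_law_cylinder:
  "emeasure (srw_law G x) {X. \<forall>i\<le>n. X i = p i} =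
     ennreal (of_bool (p 0 = x) * (\<Prod>i<n. pmf (pmf_of_set (neighbours G (p i))) (p (Suc i))))"
proof -
  define S where "S = (\<lambda>n. PiM {0..<n} (\<lambda>_::nat. count_space (UNIV :: 'a set)))"
  define A where "A = {X \<in> space (S (Suc n)). \<forall>i<Suc n. X i = p i}"
  have A_sets: "A \<in> sets (S (Suc n))"
  proof -
    have "A = PiE {0..<Suc n} (\<lambda>i. {p i})"
      by (auto simp: A_def S_def space_PiM PiE_iff extensional_def)
    then show ?thesis by (simp add: S_def sets_PiM_I_finite)
  qed
  have "{X. \<forall>i\<le>n. X i = p i} = prod_emb UNIV (\<lambda>_. count_space UNIV) {0..<Suc n} A"
    by (auto simp: prod_emb_def A_def S_def space_PiM less_Suc_eq_le)
  then have "emeasure (srw_law G x) {X. \<forall>i\<le>n. X i = p i} = emeasure (srw.CI G x {0..<Suc n}) A"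
    using srw.lim[of "{0..<Suc n}" A G x] A_sets by (simp add: srw_law_def S_def)
  also have "\<dots> = emeasure (srw.C G x 0 (Suc n) (\<lambda>_. undefined)) A"
    using A_sets sets.sets_into_space[OF A_sets]
    by (subst srw.emeasure_CI[of _ "Suc n"]) (simp_all add: S_def space_PiM prod_emb_id del: srw.C.simps)
  also have "\<dots> = (\<Prod>i<Suc n. emeasure (srw_kernel G x i p) {p i})"
    unfolding A_def S_def by (rule emeasure_srw_C_cylinder)
  also have "\<dots> = emeasure (srw_kernel G x 0 p) {p 0} * (\<Prod>i<n. emeasure (srw_kernel G x (Suc i) p) {p (Suc i)})"
    by (rule prod.lessThan_Suc_shift)
  also have "\<dots> = ennreal (of_bool (p 0 = x)) * (\<Prod>i<n. ennreal (pmf (pmf_of_set (neighbours G (p i))) (p (Suc i))))"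
    by (simp add: srw_kernel_def emeasure_pmf_single)
  finally show ?thesis
    by (simp add: prod_ennreal ennreal_mult' prod_nonneg)
qed

text \<open>Three independent walks are the coordinates of a triple of paths under the product measure.
  The property is reserved for connected, locally finite graphs, hence the first three conjuncts.\<close>

definition finite_triple_collision :: "'v pair_pre_digraph \<Rightarrow> bool" where
  "finite_triple_collision G \<longleftrightarrow>
     pair_bidirected_digraph G \<and> Digraph_Component.connected (with_proj G) \<and> locally_finite_graph G \<and>
     (\<exists>x\<in>pverts G.
        AE (X1, X2, X3) in srw_law G x \<Otimes>\<^sub>M (srw_law G x \<Otimes>\<^sub>M srw_law G x).
          finite {n. X1 n = X2 n \<and> X2 n = X3 n})"


definition comb_verts :: "(int \<Rightarrow> real) \<Rightarrow> (int \<times> nat) set" where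
  "comb_verts H = {(x, l). real l \<le> H x}"

definition comb :: "(int \<Rightarrow> real) \<Rightarrow> (int \<times> nat) pair_pre_digraph" where
  "comb H =
     \<lparr> pverts = comb_verts H,
       parcs = {((x, 0), (y, 0)) | x y. \<bar>x - y\<bar> = 1 \<and> (x, 0) \<in> comb_verts H \<and> (y, 0) \<in> comb_verts H}
         \<union> {((x, l), (x, k)) | x l k. \<bar>int l - int k\<bar> = 1 \<and> (x, l) \<in> comb_verts H \<and> (x, k) \<in> comb_verts H} \<rparr>"

end

theory Submission
  imports Defs "HOL-Real_Asymp.Real_Asymp"
begin

text \<open>
  If \<open>p n v\<close> is the law of the walk at time \<open>n\<close>, the expected number of triple collisions is
  \<open>\<Sum>n. \<Sum>v. (p n v)^3\<close>, which by reversibility is at most a constant times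
  \<open>\<Sum>n. p (2 * n) o * Max (range (p n))\<close>, \<open>o\<close> being the starting point. The uniform bound
  \<open>p n v = O(n powr (- 1/2))\<close> holds on every infinite connected graph of bounded degree, so any polynomial
  improvement of the return probability over \<open>n powr (- 1/2)\<close> makes the sum finite.
  The improvement comes from volume growth: the heat kernel has Dirichlet energy at most \<open>p m o / m\<close> at
  time of order \<open>m\<close>, hence oscillates by at most \<open>sqrt (r * p m o / m)\<close> along a path of length \<open>r\<close>, while its mean
  over a set of volume \<open>V\<close> is at most \<open>1 / V\<close>; thus \<open>p m o = O(1 / V + r / m)\<close> as soon as a ball of radius \<open>r\<close>
  around \<open>o\<close> has volume \<open>V\<close>. As \<open>\<gamma> < 1\<close>, the comb almost surely has \<open>r powr \<delta>\<close> teeth of height \<open>r\<close> within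
  distance \<open>r\<close> of the origin for some \<open>\<delta> > 0\<close>, so that \<open>V \<ge> r powr (1 + \<delta>)\<close>.
\<close>

section \<open>The heat kernel of a locally finite graph\<close>

locale rooted_graph =
  fixes N :: "'v \<Rightarrow> 'v set" and rt :: 'v
  assumes finite_N [simp]: "finite (N v)"
    and sym_N: "w \<in> N v \<Longrightarrow> v \<in> N w"
    and N_rt: "N rt \<noteq> {}"
begin

definition deg :: "'v \<Rightarrow> real" where
  "deg v = real (card (N v))"

text \<open>A real-valued edge indicator turns neighbour sums into sums over a finite square
  \<open>K \<times> K\<close>, where symmetry allows the two variables to be exchanged.\<close>

definition conductance :: "'v \<Rightarrow> 'v \<Rightarrow> real" where
  "conductance v w = of_bool (w \<in> N v)"

definition avg :: "('v \<Rightarrow> real) \<Rightarrow> 'v \<Rightarrow> real" where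
  "avg f v = (\<Sum>w\<in>N v. f w) / deg v"

text \<open>The inner product weighted by the reversible measure \<open>deg\<close>. Truncation to a
  finite \<open>K\<close> loses nothing once \<open>K\<close> contains the support of one
  factor.\<close>

definition pairing :: "'v set \<Rightarrow> ('v \<Rightarrow> real) \<Rightarrow> ('v \<Rightarrow> real) \<Rightarrow> real" where
  "pairing K f h = (\<Sum>v\<in>K. deg v * f v * h v)"

text \<open>The transition probability from \<open>rt\<close> to \<open>v\<close> divided by \<open>deg v\<close>; by reversibility it evolves by
  averaging. Isolated vertices get \<open>0 / 0 = 0\<close>.\<close>

primrec heat :: "nat \<Rightarrow> 'v \<Rightarrow> real" where
  "heat 0 = (\<lambda>v. if v = rt then 1 / deg rt else 0)"
| "heat (Suc n) = avg (heat n)"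

primrec nball :: "nat \<Rightarrow> 'v set" where
  "nball 0 = {rt}"
| "nball (Suc n) = nball n \<union> (\<Union>v\<in>nball n. N v)"

lemma conductance_sym: "conductance v w = conductance w v"
  using sym_N by (auto simp: conductance_def)

lemma conductance_nonneg [simp]: "0 \<le> conductance v w"
  by (simp add: conductance_def)

lemma deg_nonneg [simp]: "0 \<le> deg v"
  by (simp add: deg_def)

lemma deg_rt_pos: "0 < deg rt"
  using N_rt by (simp add: deg_def card_gt_0_iff)

lemma deg_ge_1: "N v \<noteq> {} \<Longrightarrow> 1 \<le> deg v"
  by (simp add: deg_def Suc_le_eq card_gt_0_iff)

lemma deg_avg: "deg v * avg f v = (\<Sum>w\<in>N v. f w)"
  by (cases "N v = {}") (auto simp: avg_def deg_def)

lemma avg_add: "avg (\<lambda>v. f v + h v) v = avg f v + avg h v"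
  by (simp add: avg_def sum.distrib add_divide_distrib)

lemma avg_diff: "avg (\<lambda>v. f v - h v) v = avg f v - avg h v"
  by (simp add: avg_def sum_subtractf diff_divide_distrib)

lemma finite_nball [simp]: "finite (nball n)"
  by (induction n) auto

lemma nball_mono: "i \<le> j \<Longrightarrow> nball i \<subseteq> nball j"
  by (rule lift_Suc_mono_le[of nball]) auto

lemma heat_nonneg: "0 \<le> heat n v"
  by (induction n arbitrary: v) (auto simp: avg_def intro!: sum_nonneg divide_nonneg_nonneg)

lemma heat_outside: "v \<notin> nball n \<Longrightarrow> heat n v = 0"
proof (induction n arbitrary: v)
  case (Suc n)
  have "heat n w = 0" if "w \<in> N v" for w
    using Suc sym_N[OF that] by auto
  then show ?case by (simp add: avg_def)
qed auto

section \<open>Reversibility, Dirichlet form and conservation of mass\<close>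

lemma sum_N_eq:
  assumes "finite K" "\<And>w. w \<notin> K \<Longrightarrow> f w = 0"
  shows "(\<Sum>w\<in>N v. f w) = (\<Sum>w\<in>K. conductance v w * f w)"
proof -
  have "(\<Sum>w\<in>N v. f w) = (\<Sum>w\<in>N v \<inter> K. f w)"
    using assms by (intro sum.mono_neutral_right) auto
  also have "\<dots> = (\<Sum>w\<in>K. if w \<in> N v then f w else 0)"
    using assms(1) by (subst sum.inter_restrict[symmetric]) (auto simp: Int_commute)
  finally show ?thesis
    by (simp add: conductance_def of_bool_def if_distrib if_distribR cong: if_cong)
qed

lemma sum_conductance_le:
  assumes "finite K" shows "(\<Sum>w\<in>K. conductance v w) \<le> deg v"
proof -
  have "(\<Sum>w\<in>K. conductance v w) = real (card (K \<inter> N v))"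
    using assms by (simp add: conductance_def flip: of_nat_sum)
  also have "\<dots> \<le> deg v"
    unfolding deg_def by (intro of_nat_mono card_mono) auto
  finally show ?thesis .
qed

lemma pairing_avg:
  assumes "finite K" "\<And>w. w \<notin> K \<Longrightarrow> h w = 0"
  shows "pairing K f (avg h) = (\<Sum>v\<in>K. \<Sum>w\<in>K. conductance v w * f v * h w)"
proof -
  have "deg v * f v * avg h v = (\<Sum>w\<in>K. conductance v w * f v * h w)" for v :: 'v
  proof -
    have "deg v * f v * avg h v = f v * (\<Sum>w\<in>K. conductance v w * h w)"
      using deg_avg[where v = v and f = h] sum_N_eq[where v = v and K = K and f = h] assms
      by (metis mult.assoc mult.commute)
    then show ?thesis by (simp add: sum_distrib_left mult_ac)
  qed
  then show ?thesis by (simp add: pairing_def)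
qed

lemma pairing_avg_sym:
  assumes "finite K" "\<And>w. w \<notin> K \<Longrightarrow> f w = 0" "\<And>w. w \<notin> K \<Longrightarrow> h w = 0"
  shows "pairing K (avg f) h = pairing K f (avg h)"
proof -
  have "pairing K (avg f) h = pairing K h (avg f)"
    by (simp add: pairing_def mult_ac)
  also have "\<dots> = (\<Sum>v\<in>K. \<Sum>w\<in>K. conductance w v * h w * f v)"
    using assms by (subst pairing_avg) (auto intro: sum.swap)
  also have "\<dots> = pairing K f (avg h)"
    using assms by (subst pairing_avg) (auto simp: conductance_sym mult_ac intro!: sum.cong)
  finally show ?thesis .
qed

text \<open>Expand the square: each of the two pure squares contributes at most
  \<open>pairing K f f\<close>, the loss coming from edges that leave \<open>K\<close>. The sign
  \<open>s\<close> treats the forms of the identity plus and minus \<open>avg\<close>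
  together.\<close>

lemma dirichlet_form_le:
  assumes K: "finite K" and f: "\<And>w. w \<notin> K \<Longrightarrow> f w = 0" and s: "s^2 = (1::real)"
  shows "(\<Sum>v\<in>K. \<Sum>w\<in>K. conductance v w * (f v + s * f w)^2)
           \<le> 2 * (pairing K f f + s * pairing K f (avg f))"
proof -
  have diag: "(\<Sum>v\<in>K. \<Sum>w\<in>K. conductance v w * (f v)^2) \<le> pairing K f f"
    unfolding pairing_def
  proof (rule sum_mono)
    fix v
    have "(\<Sum>w\<in>K. conductance v w * (f v)^2) = (\<Sum>w\<in>K. conductance v w) * (f v)^2"
      by (simp add: sum_distrib_right)
    also have "\<dots> \<le> deg v * (f v)^2"
      by (intro mult_right_mono sum_conductance_le K) auto
    finally show "(\<Sum>w\<in>K. conductance v w * (f v)^2) \<le> deg v * f v * f v"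
      by (simp add: power2_eq_square mult_ac)
  qed
  have swap: "(\<Sum>v\<in>K. \<Sum>w\<in>K. conductance v w * (f w)^2) = (\<Sum>v\<in>K. \<Sum>w\<in>K. conductance v w * (f v)^2)"
    by (subst sum.swap) (simp add: conductance_sym)
  have "conductance v w * (f v + s * f w)^2 =
      conductance v w * (f v)^2 + conductance v w * (f w)^2 + 2 * s * (conductance v w * f v * f w)" for v w
    using s by (simp add: power2_sum power_mult_distrib algebra_simps)
  then have "(\<Sum>v\<in>K. \<Sum>w\<in>K. conductance v w * (f v + s * f w)^2) =
      (\<Sum>v\<in>K. \<Sum>w\<in>K. conductance v w * (f v)^2) + (\<Sum>v\<in>K. \<Sum>w\<in>K. conductance v w * (f w)^2)
      + 2 * s * (\<Sum>v\<in>K. \<Sum>w\<in>K. conductance v w * f v * f w)"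
    by (simp add: sum.distrib sum_distrib_left)
  also have "\<dots> \<le> 2 * pairing K f f + 2 * s * pairing K f (avg f)"
    using diag by (simp add: swap pairing_avg[OF K f])
  finally show ?thesis by simp
qed

lemma heat_outside_superset: "i \<le> M \<Longrightarrow> nball M \<subseteq> K \<Longrightarrow> v \<notin> K \<Longrightarrow> heat i v = 0"
  using heat_outside nball_mono by blast

text \<open>Self-adjointness moves averaging steps from the left factor to the right one until the
  left factor is the normalised point mass at \<open>rt\<close>.\<close>

lemma pairing_heat:
  assumes K: "finite K" "nball (i + j) \<subseteq> K"
  shows "pairing K (heat i) (heat j) = heat (i + j) rt"
  using K(2)
proof (induction i arbitrary: j)
  case 0
  have "rt \<in> K" using nball_mono[of 0 j] 0 by auto
  have "pairing K (heat 0) (heat j) = (\<Sum>v\<in>K. if v = rt then heat j rt else 0)"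
    unfolding pairing_def using deg_rt_pos by (intro sum.cong) auto
  then show ?case using K(1) \<open>rt \<in> K\<close> by simp
next
  case (Suc i)
  have "pairing K (heat (Suc i)) (heat j) = pairing K (heat i) (heat (Suc j))"
    unfolding heat.simps
    by (intro pairing_avg_sym K) (auto intro: heat_outside_superset[OF _ Suc.prems])
  also have "\<dots> = heat (i + Suc j) rt"
    using Suc by (intro Suc.IH) auto
  finally show ?case by simp
qed

lemma sum_deg_heat:
  assumes K: "finite K" "nball n \<subseteq> K"
  shows "(\<Sum>v\<in>K. deg v * heat n v) = 1"
  using K(2)
proof (induction n)
  case 0
  then show ?case using K deg_rt_pos by (simp add: if_distrib if_distribR cong: if_cong)
next
  case (Suc n)
  have out: "heat n w = 0" if "w \<notin> K" for w
    using Suc.prems that by (intro heat_outside_superset[of n "Suc n"]) auto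
  have "(\<Sum>v\<in>K. deg v * heat (Suc n) v) = (\<Sum>v\<in>K. \<Sum>w\<in>K. conductance v w * heat n w)"
    by (simp add: deg_avg sum_N_eq[OF K(1) out])
  also have "\<dots> = (\<Sum>w\<in>K. (\<Sum>v\<in>K. conductance w v) * heat n w)"
    by (subst sum.swap) (simp add: sum_distrib_right conductance_sym)
  \<comment> \<open>The inner sum is the full degree where all neighbours of \<open>w\<close> lie in
    \<open>K\<close>. This is so on \<open>nball n\<close>, and \<open>heat n\<close> vanishes
    elsewhere.\<close>
  also have "\<dots> = (\<Sum>w\<in>K. deg w * heat n w)"
  proof (rule sum.cong[OF refl])
    fix w
    show "(\<Sum>v\<in>K. conductance w v) * heat n w = deg w * heat n w"
    proof (cases "w \<in> nball n")
      case True
      then have "N w \<subseteq> K" using Suc.prems by auto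
      then have "(\<Sum>v\<in>K. conductance w v) = deg w"
        using K(1) by (simp add: conductance_def deg_def flip: of_nat_sum) (simp add: Int_absorb1 flip: Int_def)
      then show ?thesis by simp
    qed (simp add: heat_outside)
  qed
  also have "\<dots> = 1" using Suc by auto
  finally show ?case .
qed

section \<open>Return probabilities: convexity, monotonicity and energy\<close>

text \<open>Only even times enter, so that \<open>ret n\<close> is the squared norm of
  \<open>heat n\<close>.\<close>

definition ret :: "nat \<Rightarrow> real" where
  "ret n = heat (2 * n) rt"

lemma ret_nonneg: "0 \<le> ret n"
  by (simp add: ret_def heat_nonneg)

text \<open>The second difference of \<open>ret\<close> is the squared norm of
  \<open>heat n - heat (n + 2)\<close>.\<close>

lemma ret_convex: "ret (Suc n) - ret (Suc (Suc n)) \<le> ret n - ret (Suc n)"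
proof -
  define K where "K = nball (2 * n + 4)"
  have ih: "pairing K (heat i) (heat j) = heat (i + j) rt" if "i + j \<le> 2 * n + 4" for i j
    unfolding K_def using that by (intro pairing_heat nball_mono) auto
  have "0 \<le> pairing K (\<lambda>v. heat n v - heat (n + 2) v) (\<lambda>v. heat n v - heat (n + 2) v)"
    unfolding pairing_def by (intro sum_nonneg) (metis deg_nonneg mult.assoc mult_nonneg_nonneg zero_le_square)
  also have "\<dots> = pairing K (heat n) (heat n) - 2 * pairing K (heat n) (heat (n + 2))
      + pairing K (heat (n + 2)) (heat (n + 2))"
    unfolding pairing_def sum_distrib_left sum.distrib[symmetric] sum_subtractf[symmetric]
    by (intro sum.cong refl) (simp add: algebra_simps del: heat.simps)
  also have "\<dots> = ret n - 2 * ret (Suc n) + ret (Suc (Suc n))"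
    using ih[of n n] ih[of n "n + 2"] ih[of "n + 2" "n + 2"]
    by (simp add: ret_def flip: mult_2 del: heat.simps)
  finally show ?thesis by simp
qed

text \<open>Adding two consecutive times removes the parity of bipartite graphs. For \<open>h = heat n - heat (Suc n)\<close>
  the nonnegative form \<open>\<langle>h, h + avg h\<rangle>\<close> is exactly what bounds the energy by an increment of \<open>ret\<close> without
  spectral theory.\<close>

lemma energy_le:
  assumes K: "finite K" "nball (2 * n + 3) \<subseteq> K"
  defines "g \<equiv> \<lambda>v. heat n v + heat (Suc n) v"
  shows "(\<Sum>v\<in>K. \<Sum>w\<in>K. conductance v w * (g v - g w)^2) \<le> 4 * (ret n - ret (Suc n))"
proof -
  have ih: "pairing K (heat i) (heat j) = heat (i + j) rt" if "i + j \<le> 2 * n + 3" for i j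
    using that K nball_mono[OF that] by (intro pairing_heat) auto
  have out: "heat i v = 0" if "i \<le> 2 * n + 3" "v \<notin> K" for i v
    using heat_outside_superset[OF that(1) K(2) that(2)] .
  define h where "h = (\<lambda>v. heat n v - heat (Suc n) v)"
  have avg_g: "avg g v = heat (Suc n) v + heat (Suc (Suc n)) v" for v
    by (simp add: g_def avg_add)
  have avg_h: "avg h v = heat (Suc n) v - heat (Suc (Suc n)) v" for v
    by (simp add: h_def avg_diff)
  have "(\<Sum>v\<in>K. \<Sum>w\<in>K. conductance v w * (g v + (-1) * g w)^2) \<le> 2 * (pairing K g g + (-1) * pairing K g (avg g))"
    by (rule dirichlet_form_le[OF K(1)]) (auto simp: g_def out simp del: heat.simps)
  moreover have "0 \<le> (\<Sum>v\<in>K. \<Sum>w\<in>K. conductance v w * (h v + 1 * h w)^2)"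
    by (intro sum_nonneg mult_nonneg_nonneg) auto
  moreover have "\<dots> \<le> 2 * (pairing K h h + 1 * pairing K h (avg h))"
    by (rule dirichlet_form_le[OF K(1)]) (auto simp: h_def out simp del: heat.simps)
  moreover have "pairing K g g - pairing K g (avg g) + (pairing K h h + pairing K h (avg h))
      = 2 * pairing K (heat n) (heat n) - 2 * pairing K (heat n) (heat (Suc (Suc n)))"
    unfolding pairing_def avg_g avg_h sum_distrib_left sum.distrib[symmetric] sum_subtractf[symmetric]
    by (intro sum.cong refl) (simp add: g_def h_def algebra_simps del: heat.simps)
  moreover have "pairing K (heat n) (heat n) = ret n" "pairing K (heat n) (heat (Suc (Suc n))) = ret (Suc n)"
    using ih[of n n] ih[of n "Suc (Suc n)"]
    by (simp_all add: ret_def flip: mult_2 del: heat.simps)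
  ultimately show ?thesis by simp
qed

lemma ret_Suc_le: "ret (Suc n) \<le> ret n"
proof -
  define g where "g = (\<lambda>v. heat n v + heat (Suc n) v)"
  have "0 \<le> (\<Sum>v\<in>nball (2 * n + 3). \<Sum>w\<in>nball (2 * n + 3). conductance v w * (g v - g w)^2)"
    by (intro sum_nonneg mult_nonneg_nonneg conductance_nonneg zero_le_power2)
  also have "\<dots> \<le> 4 * (ret n - ret (Suc n))"
    unfolding g_def by (rule energy_le[OF finite_nball order_refl])
  finally show ?thesis by simp
qed

lemma ret_antimono: "i \<le> j \<Longrightarrow> ret j \<le> ret i"
  using decseq_SucI[of ret] ret_Suc_le by (simp add: decseq_def)

text \<open>By convexity the decrement at \<open>2 * m\<close> is at most each of the
  \<open>m\<close> decrements from \<open>m\<close> on, and these telescope to at most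
  \<open>ret m\<close>.\<close>

lemma ret_increment_le:
  assumes "0 < m"
  shows "ret (2 * m) - ret (Suc (2 * m)) \<le> ret m / m"
proof -
  have "ret (2 * m) - ret (Suc (2 * m)) \<le> ret (m + i) - ret (Suc (m + i))" if "i < m" for i
  proof -
    have "decseq (\<lambda>n. ret n - ret (Suc n))"
      by (intro decseq_SucI ret_convex)
    then show ?thesis using that by (auto dest: decseqD[where i = "m + i" and j = "2 * m"])
  qed
  then have "(\<Sum>i<m. ret (2 * m) - ret (Suc (2 * m))) \<le> (\<Sum>i<m. ret (m + i) - ret (m + Suc i))"
    by (intro sum_mono) auto
  also have "\<dots> = ret m - ret (m + m)"
    by (subst sum_lessThan_telescope') simp
  also have "\<dots> \<le> ret m" using ret_nonneg by simp
  finally show ?thesis using assms by (simp add: field_simps)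
qed

section \<open>From volume growth to heat kernel bounds\<close>

text \<open>Cauchy-Schwarz along the path. Injectivity makes its edges distinct, so their squared
  increments are part of the total energy on a set \<open>K\<close> enlarged to contain the
  path.\<close>

lemma path_increment_le:
  assumes path: "\<And>i. i < k \<Longrightarrow> w (Suc i) \<in> N (w i)" and inj: "inj_on w {..k}" and m: "0 < m"
  defines "g \<equiv> \<lambda>v. heat (2 * m) v + heat (Suc (2 * m)) v"
  shows "\<bar>g (w 0) - g (w k)\<bar> \<le> 2 * sqrt (k * ret m / m)"
proof -
  define K where "K = nball (2 * (2 * m) + 3) \<union> w ` {..k}"
  have K: "finite K" "nball (2 * (2 * m) + 3) \<subseteq> K" by (auto simp: K_def)
  have "(\<Sum>i<k. (g (w i) - g (w (Suc i)))^2)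
      = (\<Sum>(v, v')\<in>(\<lambda>i. (w i, w (Suc i))) ` {..<k}. conductance v v' * (g v - g v')^2)"
    using path inj by (subst sum.reindex) (auto simp: conductance_def inj_on_def)
  also have "\<dots> \<le> (\<Sum>(v, v')\<in>K \<times> K. conductance v v' * (g v - g v')^2)"
    using K by (intro sum_mono2) (auto simp: K_def)
  also have "\<dots> = (\<Sum>v\<in>K. \<Sum>v'\<in>K. conductance v v' * (g v - g v')^2)"
    by (rule sum.cartesian_product[symmetric])
  also have "\<dots> \<le> 4 * (ret (2 * m) - ret (Suc (2 * m)))"
    unfolding g_def by (rule energy_le[OF K])
  also have "\<dots> \<le> 4 * (ret m / m)"
    using ret_increment_le[OF m] by simp
  finally have E: "(\<Sum>i<k. (g (w i) - g (w (Suc i)))^2) \<le> 4 * (ret m / m)" .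
  have "(g (w 0) - g (w k))^2 = (\<Sum>i<k. 1 * (g (w i) - g (w (Suc i))))^2"
    using sum_lessThan_telescope'[of "\<lambda>i. g (w i)" k] by simp
  also have "\<dots> \<le> (\<Sum>i<k. 1^2) * (\<Sum>i<k. (g (w i) - g (w (Suc i)))^2)"
    by (rule Cauchy_Schwarz_ineq_sum)
  also have "\<dots> \<le> k * (4 * (ret m / m))"
    using mult_left_mono[OF E, of "real k"] by simp
  finally have "\<bar>g (w 0) - g (w k)\<bar> \<le> sqrt (k * (4 * (ret m / m)))"
    by (metis real_sqrt_abs real_sqrt_le_iff)
  also have "\<dots> = sqrt (4 * (k * ret m / m))" by (simp add: mult_ac)
  also have "\<dots> = 2 * sqrt (k * ret m / m)" by (subst real_sqrt_mult) simp
  finally show ?thesis .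
qed

text \<open>On \<open>S\<close> the function is at least its value at \<open>v\<close> minus the
  oscillation along a path, while its total mass over the two times is 2 and degrees on
  \<open>S\<close> are at least 1. The unordered \<open>{w 0, w k}\<close> lets paths run in either
  direction.\<close>

lemma heat_le_volume:
  fixes r :: nat
  assumes S: "finite S" "S \<noteq> {}" and m: "0 < m" and N: "\<And>y. y \<in> S \<Longrightarrow> N y \<noteq> {}"
    and path: "\<And>y. y \<in> S \<Longrightarrow> \<exists>k w. k \<le> r \<and> {w 0, w k} = {v, y} \<and> inj_on w {..k} \<and> (\<forall>i<k. w (Suc i) \<in> N (w i))"
  shows "heat (2 * m) v + heat (Suc (2 * m)) v \<le> 2 / card S + 2 * sqrt (r * ret m / m)"
proof -
  define g where "g = (\<lambda>v. heat (2 * m) v + heat (Suc (2 * m)) v)"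
  have g0: "0 \<le> g v" for v by (auto simp: g_def intro!: add_nonneg_nonneg heat_nonneg simp del: heat.simps)
  define K where "K = S \<union> nball (Suc (2 * m))"
  have K: "finite K" "nball (Suc (2 * m)) \<subseteq> K" "nball (2 * m) \<subseteq> K"
    using S by (auto simp: K_def)
  have *: "g v - 2 * sqrt (r * ret m / m) \<le> g y" if y: "y \<in> S" for y
  proof -
    obtain k w where w: "k \<le> r" "{w 0, w k} = {v, y}" "inj_on w {..k}" "\<forall>i<k. w (Suc i) \<in> N (w i)"
      using path[OF y] by blast
    have "\<bar>g (w 0) - g (w k)\<bar> \<le> 2 * sqrt (k * ret m / m)"
      unfolding g_def by (rule path_increment_le) (use w m in auto)
    also have "\<dots> \<le> 2 * sqrt (r * ret m / m)"
      using w(1) ret_nonneg m by (intro mult_left_mono real_sqrt_le_mono divide_right_mono mult_right_mono) auto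
    finally show ?thesis using w(2) by (auto simp: doubleton_eq_iff)
  qed
  have "card S * (g v - 2 * sqrt (r * ret m / m)) = (\<Sum>y\<in>S. g v - 2 * sqrt (r * ret m / m))" by simp
  also have "\<dots> \<le> (\<Sum>y\<in>S. deg y * g y)"
  proof (rule sum_mono)
    fix y assume y: "y \<in> S"
    have "1 * g y \<le> deg y * g y" using N[OF y] deg_ge_1 g0 by (intro mult_right_mono) auto
    then show "g v - 2 * sqrt (r * ret m / m) \<le> deg y * g y" using *[OF y] by simp
  qed
  also have "\<dots> \<le> (\<Sum>y\<in>K. deg y * g y)"
    using K g0 by (intro sum_mono2) (auto simp: K_def)
  also have "\<dots> = (\<Sum>y\<in>K. deg y * heat (2 * m) y) + (\<Sum>y\<in>K. deg y * heat (Suc (2 * m)) y)"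
    by (simp add: g_def algebra_simps sum.distrib del: heat.simps)
  also have "\<dots> = 2"
    using K by (simp add: sum_deg_heat del: heat.simps nball.simps)
  finally have "g v - 2 * sqrt (r * ret m / m) \<le> 2 / card S"
    using S by (simp add: field_simps card_gt_0_iff)
  then show ?thesis by (simp add: g_def)
qed

lemma ret_le_volume:
  fixes r :: nat
  assumes S: "finite S" "S \<noteq> {}" and m: "0 < m" and N: "\<And>y. y \<in> S \<Longrightarrow> N y \<noteq> {}"
    and path: "\<And>y. y \<in> S \<Longrightarrow> \<exists>k w. k \<le> r \<and> {w 0, w k} = {rt, y} \<and> inj_on w {..k} \<and> (\<forall>i<k. w (Suc i) \<in> N (w i))"
  shows "ret m \<le> 4 / card S + 4 * real r / m"
proof -
  have "ret m \<le> heat (2 * m) rt + heat (Suc (2 * m)) rt"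
    using heat_nonneg[of "Suc (2 * m)" rt] by (simp add: ret_def)
  also have "\<dots> \<le> 2 / card S + 2 * sqrt (r * ret m / m)"
    by (rule heat_le_volume[OF assms])
  \<comment> \<open>\<open>ret m\<close> also occurs under the root. The factors are balanced so
    that the arithmetic-geometric mean inequality leaves \<open>ret m / 2\<close>, which the left
    side absorbs.\<close>
  also have "2 * sqrt (r * ret m / m) = 2 * sqrt ((ret m / 2) * (2 * real r / m))" by simp
  also have "\<dots> \<le> ret m / 2 + 2 * real r / m"
    using arith_geo_mean_sqrt[of "ret m / 2" "2 * real r / m"] ret_nonneg by simp
  finally show ?thesis by (simp add: field_simps)
qed

section \<open>Summability of the collision probabilities\<close>

text \<open>One of the three heat factors is bounded uniformly by \<open>M\<close>; the other two
  form the squared norm \<open>ret n\<close>. Two spare degrees give \<open>D^2\<close>.\<close>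

lemma sum_cube_le:
  assumes K: "finite K" "nball (2 * n) \<subseteq> K" and D: "\<And>v. deg v \<le> D"
    and M: "\<And>v. v \<in> K \<Longrightarrow> heat n v \<le> M"
  shows "(\<Sum>v\<in>K. (deg v * heat n v)^3) \<le> D^2 * M * ret n"
proof -
  have "(\<Sum>v\<in>K. (deg v * heat n v)^3) \<le> (\<Sum>v\<in>K. D^2 * M * (deg v * heat n v * heat n v))"
  proof (rule sum_mono)
    fix v assume v: "v \<in> K"
    have "(deg v)^2 * heat n v * (deg v * heat n v * heat n v) \<le> D^2 * M * (deg v * heat n v * heat n v)"
      using D[of v] M[OF v] heat_nonneg[of n v] deg_nonneg[of v]
      by (intro mult_right_mono mult_mono power_mono) auto
    then show "(deg v * heat n v)^3 \<le> D^2 * M * (deg v * heat n v * heat n v)"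
      by (simp add: power2_eq_square power3_eq_cube mult_ac)
  qed
  also have "\<dots> = D^2 * M * pairing K (heat n) (heat n)"
    by (simp add: pairing_def sum_distrib_left)
  also have "pairing K (heat n) (heat n) = ret n"
    using K by (subst pairing_heat) (auto simp: ret_def simp flip: mult_2)
  finally show ?thesis .
qed

lemma heat_isolated: "N v = {} \<Longrightarrow> 0 < n \<Longrightarrow> heat n v = 0"
  by (cases n) (auto simp: avg_def)

lemma summable_cubes:
  fixes A B D \<epsilon> :: real
  assumes D: "\<And>v. deg v \<le> D" and \<epsilon>: "0 < \<epsilon>"
    and ev: "eventually (\<lambda>m. ret m \<le> A * real m powr (- 1/2 - \<epsilon>) \<and>
      (\<forall>v. heat (2 * m) v + heat (Suc (2 * m)) v \<le> B * real m powr (- 1/2))) sequentially"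
  shows "summable (\<lambda>n. \<Sum>v\<in>nball (2 * n). (deg v * heat n v)^3)"
proof -
  obtain k where k: "\<And>m. k \<le> m \<Longrightarrow> ret m \<le> A * real m powr (- 1/2 - \<epsilon>)"
    "\<And>m v. k \<le> m \<Longrightarrow> heat (2 * m) v + heat (Suc (2 * m)) v \<le> B * real m powr (- 1/2)"
    using ev unfolding eventually_sequentially by blast
  \<comment> \<open>The factor \<open>1/4\<close> comes from \<open>real n / 4 \<le> real m\<close>
    for \<open>m = n div 2\<close>, the scale at which both bounds are applied to time
    \<open>n\<close>.\<close>
  define c where "c = D^2 * \<bar>A\<bar> * \<bar>B\<bar> * (1/4) powr (- 1 - \<epsilon>)"
  have "norm (\<Sum>v\<in>nball (2 * n). (deg v * heat n v)^3) \<le> c * real n powr (- 1 - \<epsilon>)" if n: "2 * k + 2 \<le> n" for n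
  proof -
    define m where "m = n div 2"
    have m: "k \<le> m" "0 < m" "m \<le> n" "real n / 4 \<le> real m" "n = 2 * m \<or> n = Suc (2 * m)"
      using n by (auto simp: m_def)
    have heat: "heat n v \<le> \<bar>B\<bar> * real m powr (- 1/2)" for v
    proof -
      have "heat n v \<le> heat (2 * m) v + heat (Suc (2 * m)) v"
        using m(5) heat_nonneg[of "2 * m" v] heat_nonneg[of "Suc (2 * m)" v] by (auto simp del: heat.simps)
      also have "\<dots> \<le> B * real m powr (- 1/2)" by (rule k(2)[OF m(1)])
      also have "\<dots> \<le> \<bar>B\<bar> * real m powr (- 1/2)" by (intro mult_right_mono) auto
      finally show ?thesis .
    qed
    have "ret n \<le> ret m" using m by (intro ret_antimono)
    also have "\<dots> \<le> A * real m powr (- 1/2 - \<epsilon>)" by (rule k(1)[OF m(1)])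
    also have "\<dots> \<le> \<bar>A\<bar> * real m powr (- 1/2 - \<epsilon>)" by (intro mult_right_mono) auto
    finally have ret: "ret n \<le> \<bar>A\<bar> * real m powr (- 1/2 - \<epsilon>)" .
    have "(\<Sum>v\<in>nball (2 * n). (deg v * heat n v)^3) \<le> D^2 * (\<bar>B\<bar> * real m powr (- 1/2)) * ret n"
      using D heat by (intro sum_cube_le) auto
    also have "\<dots> \<le> D^2 * (\<bar>B\<bar> * real m powr (- 1/2)) * (\<bar>A\<bar> * real m powr (- 1/2 - \<epsilon>))"
      using ret by (intro mult_left_mono) auto
    also have "\<dots> = D^2 * \<bar>A\<bar> * \<bar>B\<bar> * real m powr (- 1/2 + (- 1/2 - \<epsilon>))"
      by (simp only: powr_add mult_ac)
    also have "\<dots> = D^2 * \<bar>A\<bar> * \<bar>B\<bar> * real m powr (- 1 - \<epsilon>)" by simp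
    also have "\<dots> \<le> D^2 * \<bar>A\<bar> * \<bar>B\<bar> * (1/4 * real n) powr (- 1 - \<epsilon>)"
      using m n \<epsilon> by (intro mult_left_mono powr_mono2') auto
    also have "\<dots> = c * real n powr (- 1 - \<epsilon>)"
      by (subst powr_mult) (auto simp: c_def)
    finally show ?thesis
      by (simp add: sum_nonneg heat_nonneg)
  qed
  then have "eventually (\<lambda>n. norm (\<Sum>v\<in>nball (2 * n). (deg v * heat n v)^3) \<le> c * real n powr (- 1 - \<epsilon>)) sequentially"
    unfolding eventually_sequentially by blast
  then show ?thesis
    by (rule summable_comparison_test_ev) (use \<epsilon> in \<open>auto intro!: summable_mult simp: summable_real_powr_iff\<close>)
qed

end

section \<open>Triple collisions of the random walk\<close>

lemma measurable_srw_component [measurable]: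
  "(\<lambda>X. X i) \<in> measurable (srw_law G (x :: 'v :: countable)) (count_space UNIV)"
  by (rule measurable_compose[OF _ measurable_component_singleton[of i UNIV]])
    (auto simp: measurable_cong_sets[OF sets_srw_law refl])

lemma cylinder_in_sets_srw_law [measurable]:
  "{X. \<forall>i\<le>n. X i = p i} \<in> sets (srw_law G (x :: 'v :: countable))"
proof -
  have "{X \<in> space (srw_law G x). \<forall>i\<in>{..n}. X i = p i} \<in> sets (srw_law G x)"
    by measurable
  then show ?thesis by (simp add: Ball_def)
qed

lemma position_in_sets_srw_law [measurable]:
  "{X. X n = v} \<in> sets (srw_law G (x :: 'v :: countable))"
proof -
  have "{X \<in> space (srw_law G x). X n = v} \<in> sets (srw_law G x)" by measurable
  then show ?thesis by simp
qed

text \<open>The Markov property, from the cylinder formula: decompose over the countably many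
  histories in \<open>I\<close>, each of which gains the same factor when extended by
  \<open>w\<close>.\<close>

lemma emeasure_srw_step:
  fixes G :: "'v :: countable pair_pre_digraph"
  shows "emeasure (srw_law G x) {X. X n = v \<and> X (Suc n) = w}
    = emeasure (srw_law G x) {X. X n = v} * pmf (pmf_of_set (neighbours G v)) w"
proof -
  define I where "I = {xs. length xs = Suc n \<and> xs ! n = v}"
  define A where "A = (\<lambda>xs. {X :: nat \<Rightarrow> 'v. \<forall>i\<le>n. X i = xs ! i})"
  define B where "B = (\<lambda>xs. {X. \<forall>i\<le>Suc n. X i = (xs @ [w]) ! i})"
  have I: "xs = ys" if "xs \<in> I" "ys \<in> I" "\<forall>i\<le>n. xs ! i = ys ! i" for xs ys
    using that by (intro nth_equalityI) (auto simp: I_def)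
  have dA: "disjoint_family_on A I"
    by (fastforce simp: disjoint_family_on_def A_def dest: I)
  have BA: "B xs \<subseteq> A xs" if "xs \<in> I" for xs
    using that by (auto simp: A_def B_def I_def nth_append)
  have dB: "disjoint_family_on B I"
    using dA BA by (fastforce simp: disjoint_family_on_def)
  have mem: "map X [0..<Suc n] \<in> I \<longleftrightarrow> X n = v" for X :: "nat \<Rightarrow> 'v"
    by (simp add: I_def nth_append)
  have A: "{X. X n = v} = (\<Union>xs\<in>I. A xs)"
  proof (intro equalityI subsetI)
    fix X assume "X \<in> {X. X n = v}"
    then have "X \<in> A (map X [0..<Suc n])" "map X [0..<Suc n] \<in> I"
      by (auto simp: A_def mem nth_append less_Suc_eq_le le_less simp del: upt_Suc)
    then show "X \<in> (\<Union>xs\<in>I. A xs)" by blast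
  qed (auto simp: A_def I_def)
  have B: "{X. X n = v \<and> X (Suc n) = w} = (\<Union>xs\<in>I. B xs)"
  proof (intro equalityI subsetI)
    fix X assume X: "X \<in> {X. X n = v \<and> X (Suc n) = w}"
    have "X \<in> B (map X [0..<Suc n])"
      unfolding B_def mem_Collect_eq
    proof (intro allI impI)
      fix i assume "i \<le> Suc n"
      then consider "i < Suc n" | "i = Suc n" by linarith
      then show "X i = (map X [0..<Suc n] @ [w]) ! i"
        using X by cases (auto simp: nth_append simp del: upt_Suc)
    qed
    moreover have "map X [0..<Suc n] \<in> I" using X mem by blast
    ultimately show "X \<in> (\<Union>xs\<in>I. B xs)" by blast
  next
    fix X assume "X \<in> (\<Union>xs\<in>I. B xs)"
    then obtain xs where xs: "xs \<in> I" "\<forall>i\<le>Suc n. X i = (xs @ [w]) ! i" by (auto simp: B_def)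
    then have "X n = (xs @ [w]) ! n" "X (Suc n) = (xs @ [w]) ! Suc n" by auto
    then show "X \<in> {X. X n = v \<and> X (Suc n) = w}"
      using xs(1) by (auto simp: I_def nth_append)
  qed
  have AB: "emeasure (srw_law G x) (B xs) = emeasure (srw_law G x) (A xs) * pmf (pmf_of_set (neighbours G v)) w"
    if xs: "xs \<in> I" for xs
  proof -
    have len: "length xs = Suc n" and last: "xs ! n = v" using xs by (auto simp: I_def)
    have "(\<Prod>i<n. pmf (pmf_of_set (neighbours G ((xs @ [w]) ! i))) ((xs @ [w]) ! Suc i))
        = (\<Prod>i<n. pmf (pmf_of_set (neighbours G (xs ! i))) (xs ! Suc i))"
      using len by (intro prod.cong) (auto simp: nth_append)
    moreover have "(xs @ [w]) ! 0 = xs ! 0" "(xs @ [w]) ! n = v" "(xs @ [w]) ! Suc n = w"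
      using len last by (auto simp: nth_append)
    ultimately show ?thesis
      unfolding A_def B_def emeasure_srw_law_cylinder prod.lessThan_Suc
      by (simp add: mult.assoc prod_nonneg flip: ennreal_mult')
  qed
  have "emeasure (srw_law G x) {X. X n = v \<and> X (Suc n) = w}
      = (\<integral>\<^sup>+xs. emeasure (srw_law G x) (B xs) \<partial>count_space I)"
    unfolding B using dB by (intro emeasure_UN_countable) (auto simp: B_def)
  also have "\<dots> = (\<integral>\<^sup>+xs. emeasure (srw_law G x) (A xs) * pmf (pmf_of_set (neighbours G v)) w \<partial>count_space I)"
    by (intro nn_integral_cong AB) simp
  also have "\<dots> = (\<integral>\<^sup>+xs. emeasure (srw_law G x) (A xs) \<partial>count_space I) * pmf (pmf_of_set (neighbours G v)) w"
    by (intro nn_integral_multc) simp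
  also have "(\<integral>\<^sup>+xs. emeasure (srw_law G x) (A xs) \<partial>count_space I) = emeasure (srw_law G x) {X. X n = v}"
    unfolding A using dA by (intro emeasure_UN_countable[symmetric]) (auto simp: A_def)
  finally show ?thesis .
qed

text \<open>In the forward recursion the factor \<open>deg v\<close> cancels the jump probability
  \<open>1 / deg v\<close>, which leaves the averaging that defines \<open>heat\<close>.\<close>

lemma emeasure_srw_position:
  fixes G :: "'v :: countable pair_pre_digraph"
  assumes "rooted_graph (neighbours G) x"
  shows "emeasure (srw_law G x) {X. X n = v}
    = ennreal (rooted_graph.deg (neighbours G) v * rooted_graph.heat (neighbours G) x n v)"
proof -
  interpret rooted_graph "neighbours G" x by fact
  show ?thesis
  proof (induction n arbitrary: v)
    case 0
    show ?case
      using emeasure_srw_law_cylinder[of G x 0 "\<lambda>_. v"] deg_rt_pos by auto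
  next
    case (Suc n w)
    have mass: "deg v * heat n v * pmf (pmf_of_set (neighbours G v)) w = of_bool (v \<in> neighbours G w) * heat n v" for v
    proof (cases "neighbours G v = {}")
      \<comment> \<open>The value of \<open>pmf_of_set {}\<close> is unspecified, but
        \<open>deg v = 0\<close> annihilates it.\<close>
      case True
      then show ?thesis using sym_N[of v w] by (auto simp: deg_def)
    next
      case False
      then show ?thesis
        using sym_N[of v w] sym_N[of w v] deg_ge_1[OF False]
        by (auto simp: pmf_of_set deg_def indicator_def)
    qed
    have "{X. X (Suc n) = w} = (\<Union>v. {X. X n = v \<and> X (Suc n) = w})" by auto
    also have "emeasure (srw_law G x) \<dots> = (\<integral>\<^sup>+v. emeasure (srw_law G x) {X. X n = v \<and> X (Suc n) = w} \<partial>count_space UNIV)"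
    proof (rule emeasure_UN_countable)
      have "{X \<in> space (srw_law G x). X n = v \<and> X (Suc n) = w} \<in> sets (srw_law G x)" for v by measurable
      then show "{X. X n = v \<and> X (Suc n) = w} \<in> sets (srw_law G x)" for v by simp
    qed (auto simp: disjoint_family_on_def)
    also have "\<dots> = (\<integral>\<^sup>+v. ennreal (of_bool (v \<in> neighbours G w) * heat n v) \<partial>count_space UNIV)"
      by (intro nn_integral_cong) (simp add: emeasure_srw_step Suc.IH heat_nonneg flip: ennreal_mult' mass)
    also have "\<dots> = (\<Sum>v\<in>neighbours G w. ennreal (of_bool (v \<in> neighbours G w) * heat n v))"
      by (intro nn_integral_count_space') auto
    also have "\<dots> = ennreal (\<Sum>v\<in>neighbours G w. heat n v)"
      using heat_nonneg by (subst sum_ennreal[symmetric]) (auto intro!: sum.cong)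
    also have "\<dots> = ennreal (deg w * heat (Suc n) w)"
      by (simp add: deg_avg)
    finally show ?case .
  qed
qed

text \<open>By independence all three walks are at \<open>v\<close> at time \<open>n\<close> with
  probability a cube; sum over \<open>v\<close> and apply Borel-Cantelli. \<open>heat n\<close>
  already lives on \<open>nball n\<close>; the radius \<open>2 * n\<close> is the one
  \<open>sum_cube_le\<close> requires.\<close>

lemma AE_finite_triple_collisions:
  fixes G :: "'v :: countable pair_pre_digraph"
  assumes "rooted_graph (neighbours G) x"
    and "summable (\<lambda>n. \<Sum>v\<in>rooted_graph.nball (neighbours G) x (2 * n).
      (rooted_graph.deg (neighbours G) v * rooted_graph.heat (neighbours G) x n v)^3)"
  shows "AE (X1, X2, X3) in srw_law G x \<Otimes>\<^sub>M (srw_law G x \<Otimes>\<^sub>M srw_law G x).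
    finite {n. X1 n = X2 n \<and> X2 n = X3 n}"
proof -
  interpret rooted_graph "neighbours G" x by fact
  let ?L = "srw_law G x"
  let ?M = "?L \<Otimes>\<^sub>M (?L \<Otimes>\<^sub>M ?L)"
  interpret L: prob_space ?L by (rule prob_space_srw_law)
  interpret LL: pair_prob_space ?L ?L ..
  interpret LLL: pair_prob_space ?L "?L \<Otimes>\<^sub>M ?L" ..
  define E where "E = (\<lambda>v n. {X. X n = v} \<times> {X. X n = v} \<times> {X :: nat \<Rightarrow> 'v. X n = v})"
  define A where "A = (\<lambda>n. \<Union>v. E v n)"
  have E_sets [measurable]: "E v n \<in> sets ?M" for v n
    unfolding E_def by measurable
  have A_sets [measurable]: "A n \<in> sets ?M" for n
    unfolding A_def by measurable
  have E: "emeasure ?M (E v n) = ennreal ((deg v * heat n v)^3)" for v n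
    unfolding E_def
    by (simp add: L.emeasure_pair_measure_Times LL.P.emeasure_pair_measure_Times
        emeasure_srw_position[OF assms(1)]
        power3_eq_cube heat_nonneg mult.assoc flip: ennreal_mult')
  have "emeasure ?M (A n) = ennreal (\<Sum>v\<in>nball (2 * n). (deg v * heat n v)^3)" for n
  proof -
    have out: "heat n v = 0" if "v \<notin> nball (2 * n)" for v
      by (rule heat_outside_superset[OF _ order_refl that]) simp
    have "emeasure ?M (A n) = (\<integral>\<^sup>+v. emeasure ?M (E v n) \<partial>count_space UNIV)"
      unfolding A_def by (intro emeasure_UN_countable) (auto simp: disjoint_family_on_def E_def)
    also have "\<dots> = (\<Sum>v\<in>nball (2 * n). ennreal ((deg v * heat n v)^3))"
      unfolding E
      by (intro nn_integral_count_space') (auto simp: out)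
    finally show ?thesis
      by (simp add: sum_ennreal heat_nonneg)
  qed
  then have "measure ?M (A n) = (\<Sum>v\<in>nball (2 * n). (deg v * heat n v)^3)" for n
    by (simp add: measure_def sum_nonneg heat_nonneg)
  then have "AE X in ?M. eventually (\<lambda>n. X \<in> space ?M - A n) sequentially"
    using assms(2) by (intro borel_cantelli_AE1) (auto simp: LLL.P.emeasure_eq_measure)
  then show ?thesis
  proof (rule AE_mp, intro AE_I2 impI)
    fix X assume "eventually (\<lambda>n. X \<in> space ?M - A n) sequentially"
    then obtain k where "\<forall>n\<ge>k. X \<notin> A n" by (auto simp: eventually_sequentially)
    then have "{n. X \<in> A n} \<subseteq> {..<k}" by (auto simp: not_le[symmetric])
    then have "finite {n. X \<in> A n}" by (rule finite_subset) simp
    moreover have "{n. X \<in> A n} = {n. fst X n = fst (snd X) n \<and> fst (snd X) n = snd (snd X) n}"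
      by (cases X) (auto simp: A_def E_def)
    ultimately show "case X of (X1, X2, X3) \<Rightarrow> finite {n. X1 n = X2 n \<and> X2 n = X3 n}"
      by (simp add: case_prod_beta)
  qed
qed

section \<open>Geometry of the comb\<close>

lemma neighbours_comb:
  assumes "\<And>x. 0 \<le> H x"
  shows "w \<in> neighbours (comb H) v \<longleftrightarrow> v \<in> comb_verts H \<and> w \<in> comb_verts H \<and>
    (snd v = 0 \<and> snd w = 0 \<and> \<bar>fst v - fst w\<bar> = 1 \<or> fst v = fst w \<and> \<bar>int (snd v) - int (snd w)\<bar> = 1)"
  by (cases v; cases w) (auto simp: neighbours_def comb_def)

text \<open>Source of local finiteness and of the degree bound 4. For \<open>l = 0\<close> truncated
  subtraction gives \<open>(x, 0)\<close> itself, which only enlarges the superset.\<close>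

lemma neighbours_comb_subset:
  "neighbours (comb H) (x, l) \<subseteq> {(x - 1, 0), (x + 1, 0), (x, l + 1), (x, l - 1)}"
  by (auto simp: neighbours_def comb_def)

lemma finite_neighbours_comb [simp]: "finite (neighbours (comb H) v)"
  by (cases v) (use finite_subset[OF neighbours_comb_subset] in blast)

text \<open>Walk down the tooth to the spine, then along the spine to the right. Every vertex with \<open>x \<le> 0\<close>
  thereby reaches the origin, so it suffices to look for tall teeth on the left half line.\<close>

definition descent :: "int \<times> nat \<Rightarrow> nat \<Rightarrow> int \<times> nat" where
  "descent v i = (if i \<le> snd v then (fst v, snd v - i) else (fst v + int (i - snd v), 0))"

lemma descent_0 [simp]: "descent v 0 = v"
  by (simp add: descent_def)

lemma inj_descent: "inj (descent v)"
  by (rule injI) (auto simp: descent_def split: if_splits)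

lemma descent_spine: "descent v (snd v + k) = (fst v + int k, 0)"
  by (auto simp: descent_def)

lemma descent_in_verts: "(\<And>x. 0 \<le> H x) \<Longrightarrow> v \<in> comb_verts H \<Longrightarrow> descent v i \<in> comb_verts H"
  by (cases v) (auto simp: descent_def comb_verts_def intro: order_trans[rotated])

lemma descent_step:
  assumes "\<And>x. 0 \<le> H x" "v \<in> comb_verts H"
  shows "descent v (Suc i) \<in> neighbours (comb H) (descent v i)"
proof -
  have "descent v i \<in> comb_verts H" "descent v (Suc i) \<in> comb_verts H"
    using assms by (auto intro: descent_in_verts)
  then show ?thesis
    unfolding neighbours_comb[OF assms(1)] by (auto simp: descent_def)
qed

lemma rooted_graph_comb:
  assumes H: "\<And>x. 0 \<le> H x"
  shows "rooted_graph (neighbours (comb H)) (0, 0)"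
proof
  show "v \<in> neighbours (comb H) w" if "w \<in> neighbours (comb H) v" for v w
    using that unfolding neighbours_comb[OF H] by auto
  have "(0, 0) \<in> comb_verts H" using H by (simp add: comb_verts_def)
  then show "neighbours (comb H) (0, 0) \<noteq> {}"
    using descent_step[of H "(0, 0)" 0] H by auto
qed simp

lemma comb_graph:
  assumes H: "\<And>x. 0 \<le> H x"
  shows "pair_bidirected_digraph (comb H)" "Digraph_Component.connected (with_proj (comb H))"
    "locally_finite_graph (comb H)"
proof -
  show bi: "pair_bidirected_digraph (comb H)"
    by unfold_locales (auto simp: comb_def symmetric_def intro!: symI)
  show "locally_finite_graph (comb H)"
    by (simp add: locally_finite_graph_def)
  interpret pair_bidirected_digraph "comb H" by fact
  have verts: "pverts (comb H) = comb_verts H" by (simp add: comb_def)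
  have desc: "v \<rightarrow>\<^sup>*\<^bsub>with_proj (comb H)\<^esub> descent v i" if v: "v \<in> comb_verts H" for v i
  proof (induction i)
    case 0
    then show ?case using v by (simp add: verts)
  next
    case (Suc i)
    have "(descent v i, descent v (Suc i)) \<in> parcs (comb H)"
      using descent_step[of H v i] H v by (simp add: neighbours_def)
    with Suc show ?case by (rule reachable_adj_trans)
  qed
  have sym: "v \<rightarrow>\<^sup>*\<^bsub>with_proj (comb H)\<^esub> u" if "u \<rightarrow>\<^sup>*\<^bsub>with_proj (comb H)\<^esub> v" for u v
    using that pair_sym_arcs by (metis symmetric_reachable)
  have conn: "u \<rightarrow>\<^sup>*\<^bsub>with_proj (comb H)\<^esub> v" if u: "u \<in> comb_verts H" and v: "v \<in> comb_verts H" for u v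
  proof -
    \<comment> \<open>Descents run along the spine only to the right, so they can first be made to
      meet in the rightmost of the two columns.\<close>
    define y where "y = max (fst u) (fst v)"
    have "descent u (snd u + nat (y - fst u)) = (y, 0)" "descent v (snd v + nat (y - fst v)) = (y, 0)"
      unfolding descent_spine by (auto simp: y_def)
    then have "u \<rightarrow>\<^sup>*\<^bsub>with_proj (comb H)\<^esub> (y, 0)" "(y, 0) \<rightarrow>\<^sup>*\<^bsub>with_proj (comb H)\<^esub> v"
      using desc[OF u] sym[OF desc[OF v]] by metis+
    then show ?thesis by (rule reachable_trans)
  qed
  have "(0, 0) \<in> comb_verts H" using H by (simp add: comb_verts_def)
  then show "Digraph_Component.connected (with_proj (comb H))"
    unfolding connected_def using conn
    by (intro strongly_connectedI) (auto simp: verts intro!: reachable_mk_symmetricI)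
qed

section \<open>Tall teeth\<close>

lemma nat_ceiling_bounds:
  assumes "1 \<le> (x :: real)"
  shows "x \<le> real (nat \<lceil>x\<rceil>)" "real (nat \<lceil>x\<rceil>) \<le> 2 * x"
  using assms by linarith+

text \<open>The factor \<open>x powr 2\<close> allows comparison of the failure probability at scale
  \<open>m\<close> with the summable \<open>m powr (- 2)\<close>.\<close>

lemma powr_exp_decay:
  fixes e c :: real
  assumes "0 < e" "0 < c"
  shows "((\<lambda>x. 2 * x powr (2 * e) * exp (- c * x powr (3 * e)) * x powr 2) \<longlongrightarrow> 0) at_top"
  using assms by real_asymp

lemma (in prob_space) prob_all_le_iid:
  fixes H :: "int \<Rightarrow> 'a \<Rightarrow> real"
  assumes indep: "indep_vars (\<lambda>_. borel) H UNIV"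
    and ident: "\<And>x. distr M borel (H x) = distr M borel (H 0)"
    and J: "finite J" "J \<noteq> {}"
  shows "prob {\<omega> \<in> space M. \<forall>x\<in>J. H x \<omega> \<le> z} = (1 - prob {\<omega> \<in> space M. z < H 0 \<omega>}) ^ card J"
proof -
  have meas [measurable]: "H x \<in> borel_measurable M" for x
    using indep by (auto simp: indep_vars_def)
  have "{\<omega> \<in> space M. \<forall>x\<in>J. H x \<omega> \<le> z} = (\<Inter>x\<in>J. H x -` {..z} \<inter> space M)"
    using J by auto
  also have "prob \<dots> = (\<Prod>x\<in>J. prob (H x -` {..z} \<inter> space M))"
    using J by (intro indep_varsD[OF indep]) auto
  also have "\<dots> = (\<Prod>x\<in>J. 1 - prob {\<omega> \<in> space M. z < H 0 \<omega>})"
  proof (rule prod.cong[OF refl])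
    fix x
    have "prob (H x -` {..z} \<inter> space M) = measure (distr M borel (H x)) {..z}"
      by (simp add: measure_distr)
    also have "\<dots> = measure (distr M borel (H 0)) {..z}" 
      by (rule arg_cong[OF ident])
    also have "\<dots> = prob (space M - {\<omega> \<in> space M. z < H 0 \<omega>})"
    proof -
      have "H 0 -` {..z} \<inter> space M = space M - {\<omega> \<in> space M. z < H 0 \<omega>}" by auto
      then show ?thesis by (simp add: measure_distr)
    qed
    also have "\<dots> = 1 - prob {\<omega> \<in> space M. z < H 0 \<omega>}"
      by (rule prob_compl) measurable
    finally show "prob (H x -` {..z} \<inter> space M) = 1 - prob {\<omega> \<in> space M. z < H 0 \<omega>}" .
  qed
  finally show ?thesis by simp
qed

text \<open>The interval of length \<open>r = num_blocks \<eta> m * block_length \<eta> m\<close>, of order \<open>m powr (1/2 - \<eta>)\<close>, is cut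
  into blocks so long that, eventually in \<open>m\<close>, each contains a tooth taller than \<open>r\<close>. The volume near the origin is then
  at least \<open>num_blocks \<eta> m * r\<close>, of order \<open>m powr (1/2 + \<eta>)\<close>.\<close>

definition num_blocks :: "real \<Rightarrow> nat \<Rightarrow> nat" where
  "num_blocks \<eta> m = nat \<lceil>real m powr (2 * \<eta>)\<rceil>"

definition block_length :: "real \<Rightarrow> nat \<Rightarrow> nat" where
  "block_length \<eta> m = nat \<lceil>real m powr (1/2 - 3 * \<eta>)\<rceil>"

text \<open>\<open>\<eta> < 1/12\<close> keeps the exponent \<open>1/2 - 3 * \<eta>\<close>
  positive, so both powers are at least 1 and each ceiling costs at most a factor 2.\<close>

lemma block_bounds:
  assumes "0 < \<eta>" "\<eta> < 1/12" "1 \<le> m"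
  shows "real m powr (2 * \<eta>) \<le> real (num_blocks \<eta> m)" "real (num_blocks \<eta> m) \<le> 2 * real m powr (2 * \<eta>)"
    "real m powr (1/2 - 3 * \<eta>) \<le> real (block_length \<eta> m)"
    "real m powr (1/2 - \<eta>) \<le> real (num_blocks \<eta> m * block_length \<eta> m)"
    "real (num_blocks \<eta> m * block_length \<eta> m) \<le> 4 * real m powr (1/2 - \<eta>)"
proof -
  have 1: "1 \<le> real m powr (2 * \<eta>)" "1 \<le> real m powr (1/2 - 3 * \<eta>)"
    using assms by (auto intro: ge_one_powr_ge_zero)
  note L = nat_ceiling_bounds[OF 1(1), folded num_blocks_def]
  note b = nat_ceiling_bounds[OF 1(2), folded block_length_def]
  show "real m powr (2 * \<eta>) \<le> real (num_blocks \<eta> m)" "real (num_blocks \<eta> m) \<le> 2 * real m powr (2 * \<eta>)"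
    "real m powr (1/2 - 3 * \<eta>) \<le> real (block_length \<eta> m)"
    using L b by auto
  have split: "real m powr (1/2 - \<eta>) = real m powr (2 * \<eta>) * real m powr (1/2 - 3 * \<eta>)"
    by (simp flip: powr_add)
  show "real m powr (1/2 - \<eta>) \<le> real (num_blocks \<eta> m * block_length \<eta> m)"
    unfolding split of_nat_mult using L b by (intro mult_mono) auto
  have "real (num_blocks \<eta> m * block_length \<eta> m) \<le> (2 * real m powr (2 * \<eta>)) * (2 * real m powr (1/2 - 3 * \<eta>))"
    unfolding of_nat_mult using L b by (intro mult_mono) auto
  then show "real (num_blocks \<eta> m * block_length \<eta> m) \<le> 4 * real m powr (1/2 - \<eta>)"
    by (simp add: split)
qed

text \<open>The expected number of teeth taller than \<open>r\<close> in a block is at least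
  \<open>c * m powr (3 * \<eta>)\<close>, so a block has none with probability at most
  \<open>exp (- c * m powr (3 * \<eta>))\<close>. A union bound over the blocks and Borel-Cantelli
  finish.\<close>

lemma (in prob_space) AE_tall_teeth:
  fixes H :: "int \<Rightarrow> 'a \<Rightarrow> real"
  assumes \<gamma>: "0 < \<gamma>" "\<gamma> < 1" and C: "0 < C"
    and indep: "indep_vars (\<lambda>_. borel) H UNIV"
    and ident: "\<And>x. distr M borel (H x) = distr M borel (H 0)"
    and tail: "((\<lambda>z. z powr \<gamma> * prob {\<omega> \<in> space M. z < H 0 \<omega>}) \<longlongrightarrow> C) at_top"
    and \<eta>: "\<eta> = (1 - \<gamma>) / 12"
  shows "AE \<omega> in M. eventually (\<lambda>m. \<forall>j<num_blocks \<eta> m. \<exists>i<block_length \<eta> m.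
    real (num_blocks \<eta> m * block_length \<eta> m) < H (- int (j * block_length \<eta> m + i)) \<omega>) sequentially"
proof -
  define L where "L = num_blocks \<eta>"
  define b where "b = block_length \<eta>"
  define r where "r = (\<lambda>m. L m * b m)"
  define t where "t = (\<lambda>z. prob {\<omega> \<in> space M. z < H 0 \<omega>})"
  \<comment> \<open>\<open>C / 2\<close> is an eventual lower bound for the normalised tail;
    \<open>4 powr (- \<gamma>)\<close> comes from the upper bound on \<open>r\<close>.\<close>
  define c where "c = C / 2 * 4 powr (- \<gamma>)"
  have c: "0 < c" using C by (simp add: c_def)
  have \<eta>': "0 < \<eta>" "\<eta> < 1/12" using \<gamma> by (auto simp: \<eta>)
  note bounds = block_bounds[OF \<eta>', folded L_def b_def r_def]
  have bounds_r: "real m powr (1/2 - \<eta>) \<le> real (r m)" "real (r m) \<le> 4 * real m powr (1/2 - \<eta>)" if "1 \<le> m" for m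
    using bounds(4,5)[OF that] by (auto simp: r_def)
  have meas [measurable]: "H x \<in> borel_measurable M" for x
    using indep by (auto simp: indep_vars_def)
  define E where "E = (\<lambda>m j. {\<omega> \<in> space M. \<forall>x\<in>(\<lambda>i. - int (j * b m + i)) ` {..<b m}. H x \<omega> \<le> real (r m)})"
  define bad where "bad = (\<lambda>m. \<Union>j<L m. E m j)"
  have E_sets [measurable]: "E m j \<in> sets M" for m j
    unfolding E_def by measurable
  have bad_sets [measurable]: "bad m \<in> sets M" for m
    unfolding bad_def by measurable
  have "eventually (\<lambda>z. C / 2 < z powr \<gamma> * t z) at_top"
    using order_tendstoD(1)[OF tail, of "C / 2"] C by (simp add: t_def)
  then have ev_t: "eventually (\<lambda>z. C / 2 * z powr (- \<gamma>) \<le> t z) at_top"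
    using eventually_gt_at_top[of 0]
    by eventually_elim (simp add: powr_minus field_simps)
  have "filterlim (\<lambda>m. real m powr (1/2 - \<eta>)) at_top sequentially"
    using \<eta>' by (intro filterlim_compose[OF real_powr_at_top filterlim_real_sequentially]) auto
  then have "filterlim (\<lambda>m. real (r m)) at_top sequentially"
    by (rule filterlim_at_top_mono) (use bounds_r in \<open>auto intro: eventually_mono[OF eventually_ge_at_top[of 1]]\<close>)
  then have ev_r: "eventually (\<lambda>m. C / 2 * real (r m) powr (- \<gamma>) \<le> t (real (r m))) sequentially"
    by (rule eventually_compose_filterlim[OF ev_t])
  have prob_bad: "eventually (\<lambda>m. prob (bad m) \<le> 2 * real m powr (2 * \<eta>) * exp (- c * real m powr (3 * \<eta>))) sequentially"
    using ev_r eventually_ge_at_top[of 1]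
  proof eventually_elim
    case (elim m)
    have m: "1 \<le> real m" using elim by simp
    have b: "0 < b m" using bounds(3)[OF elim(2)] m by (cases "b m = 0") auto
    have r: "0 < real (r m)" using bounds_r(1)[OF elim(2)] m by (cases "r m = 0") auto
    have "c * real m powr (- (\<gamma> * (1/2 - \<eta>))) = C / 2 * (4 * real m powr (1/2 - \<eta>)) powr (- \<gamma>)"
      using m by (simp add: c_def powr_mult powr_powr mult_ac)
    also have "\<dots> \<le> C / 2 * real (r m) powr (- \<gamma>)"
      using bounds_r(2)[OF elim(2)] r \<gamma> C by (intro mult_left_mono powr_mono2') auto
    also have "\<dots> \<le> t (real (r m))" by (rule elim(1))
    finally have t: "c * real m powr (- (\<gamma> * (1/2 - \<eta>))) \<le> t (real (r m))" .
    have "c * real m powr (3 * \<eta>) \<le> c * real m powr ((1/2 - 3 * \<eta>) + (- (\<gamma> * (1/2 - \<eta>))))"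
    proof (intro mult_left_mono powr_mono)
      \<comment> \<open>As 1 - \<gamma> = 12 \<eta>, the gain (1 - \<gamma>) / 2 = 6 \<eta> pays for
        the 3 \<eta> by which blocks are shortened and leaves at least 3 \<eta>.\<close>
      have "(1/2 - 3 * \<eta>) + (- (\<gamma> * (1/2 - \<eta>))) = 3 * \<eta> + \<gamma> * \<eta>"
        by (simp add: \<eta> field_simps)
      then show "3 * \<eta> \<le> (1/2 - 3 * \<eta>) + (- (\<gamma> * (1/2 - \<eta>)))"
        using \<gamma> \<eta>' by simp
    qed (use m c in auto)
    also have "\<dots> = real m powr (1/2 - 3 * \<eta>) * (c * real m powr (- (\<gamma> * (1/2 - \<eta>))))"
      by (simp only: powr_add mult_ac)
    also have "\<dots> \<le> real (b m) * t (real (r m))"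
      using t bounds(3)[OF elim(2)] c by (intro mult_mono) auto
    finally have bt: "c * real m powr (3 * \<eta>) \<le> real (b m) * t (real (r m))" .
    have "prob (E m j) \<le> exp (- c * real m powr (3 * \<eta>))" for j
    proof -
      have "card ((\<lambda>i. - int (j * b m + i)) ` {..<b m}) = b m"
        by (subst card_image) (auto intro: inj_onI)
      then have "prob (E m j) = (1 - t (real (r m))) ^ b m"
        unfolding E_def t_def using b
        by (subst prob_all_le_iid[OF indep ident]) (auto simp only: finite_imageI finite_lessThan image_is_empty lessThan_empty_iff)
      also have "\<dots> \<le> exp (- t (real (r m))) ^ b m"
        using exp_ge_add_one_self[of "- t (real (r m))"] by (intro power_mono) (auto simp: t_def)
      also have "\<dots> = exp (- (real (b m) * t (real (r m))))"
        by (simp flip: exp_of_nat_mult)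
      also have "\<dots> \<le> exp (- c * real m powr (3 * \<eta>))" using bt by simp
      finally show ?thesis .
    qed
    then have "(\<Sum>j<L m. prob (E m j)) \<le> (\<Sum>j<L m. exp (- c * real m powr (3 * \<eta>)))"
      by (intro sum_mono)
    moreover have "prob (bad m) \<le> (\<Sum>j<L m. prob (E m j))"
      unfolding bad_def by (intro finite_measure_subadditive_finite) auto
    ultimately have "prob (bad m) \<le> real (L m) * exp (- c * real m powr (3 * \<eta>))" by simp
    also have "\<dots> \<le> 2 * real m powr (2 * \<eta>) * exp (- c * real m powr (3 * \<eta>))"
      using bounds(2)[OF elim(2)] by (intro mult_right_mono) auto
    finally show ?case .
  qed
  have "(\<lambda>m. 2 * real m powr (2 * \<eta>) * exp (- c * real m powr (3 * \<eta>)) * real m powr 2) \<longlonglongrightarrow> 0"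
    by (rule filterlim_compose[OF powr_exp_decay[OF \<eta>'(1) c] filterlim_real_sequentially])
  from order_tendstoD(2)[OF this zero_less_one] prob_bad eventually_ge_at_top[of 1]
  have "eventually (\<lambda>m. norm (prob (bad m)) \<le> real m powr (- 2)) sequentially"
  proof eventually_elim
    case (elim m)
    have "0 < real m powr 2" using elim by auto
    moreover have "2 * real m powr (2 * \<eta>) * exp (- c * real m powr (3 * \<eta>)) \<le> 1 / real m powr 2"
      using elim(1,3) by (simp add: field_simps)
    ultimately show ?case using elim(2) by (simp add: powr_minus inverse_eq_divide)
  qed
  then have "summable (\<lambda>m. prob (bad m))"
    by (rule summable_comparison_test_ev) (simp add: summable_real_powr_iff)
  then have "AE \<omega> in M. eventually (\<lambda>m. \<omega> \<in> space M - bad m) sequentially"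
    by (intro borel_cantelli_AE1) (auto simp: emeasure_eq_measure)
  then show ?thesis
  proof (rule AE_mp, intro AE_I2 impI)
    fix \<omega> assume \<omega>: "\<omega> \<in> space M" and ev: "eventually (\<lambda>m. \<omega> \<in> space M - bad m) sequentially"
    from ev show "eventually (\<lambda>m. \<forall>j<num_blocks \<eta> m. \<exists>i<block_length \<eta> m.
      real (num_blocks \<eta> m * block_length \<eta> m) < H (- int (j * block_length \<eta> m + i)) \<omega>) sequentially"
    proof eventually_elim
      case (elim m)
      show ?case
      proof (intro allI impI)
        fix j assume "j < num_blocks \<eta> m"
        then have "\<omega> \<notin> E m j" using elim by (auto simp: bad_def L_def)
        then show "\<exists>i<block_length \<eta> m. real (num_blocks \<eta> m * block_length \<eta> m) < H (- int (j * block_length \<eta> m + i)) \<omega>"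
          using \<omega> by (auto simp: E_def b_def r_def L_def not_le)
      qed
    qed
  qed
qed

section \<open>Heat kernel bounds on the comb\<close>

text \<open>Teeth chosen from different blocks stand in different columns: division by
  \<open>b\<close> recovers the block.\<close>

lemma inj_on_block:
  assumes "\<And>j. j < L \<Longrightarrow> i j < (b :: nat)"
  shows "inj_on (\<lambda>j. j * b + i j) {..<L}"
proof (rule inj_onI)
  fix j j' assume j: "j \<in> {..<L}" "j' \<in> {..<L}" and eq: "j * b + i j = j' * b + i j'"
  have "(j * b + i j) div b = j" "(j' * b + i j') div b = j'"
    using j assms[of j] assms[of j'] by auto
  with eq show "j = j'" by metis
qed

text \<open>\<open>S\<close> consists of the lowest \<open>r + 1\<close> vertices of one tall tooth
  per block. Each reaches the origin by at most \<open>r\<close> steps down and at most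
  \<open>r\<close> along the spine, whence the path length \<open>2 * r\<close>.\<close>

lemma comb_ret_le:
  fixes H :: "int \<Rightarrow> real"
  assumes H: "\<And>x. 0 \<le> H x" and \<eta>: "0 < \<eta>" "\<eta> < 1/12" and m: "1 \<le> m"
    and tall: "\<forall>j<num_blocks \<eta> m. \<exists>i<block_length \<eta> m.
      real (num_blocks \<eta> m * block_length \<eta> m) < H (- int (j * block_length \<eta> m + i))"
  shows "rooted_graph.ret (neighbours (comb H)) (0, 0) m \<le> 36 * real m powr (- 1/2 - \<eta>)"
proof -
  interpret rooted_graph "neighbours (comb H)" "(0, 0)" by (rule rooted_graph_comb[OF H])
  define L where "L = num_blocks \<eta> m"
  define b where "b = block_length \<eta> m"
  define r where "r = L * b"
  note bounds = block_bounds[OF \<eta> m, folded L_def b_def r_def]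
  have m': "1 \<le> real m" using m by simp
  have L: "0 < L" using bounds(1) m' by (cases "L = 0") auto
  obtain i where i: "\<And>j. j < L \<Longrightarrow> i j < b" "\<And>j. j < L \<Longrightarrow> real r < H (- int (j * b + i j))"
    using tall unfolding L_def[symmetric] b_def[symmetric] r_def[symmetric] by metis
  define S where "S = (\<lambda>(j, l). (- int (j * b + i j), l)) ` ({..<L} \<times> {..r})"
  have "inj_on (\<lambda>(j, l :: nat). (- int (j * b + i j), l)) ({..<L} \<times> {..r})"
    using inj_on_block[of L i b, OF i(1)] by (auto simp: inj_on_def simp flip: of_nat_mult of_nat_add)
  then have card: "card S = L * Suc r"
    by (simp add: S_def card_image card_cartesian_product)
  have S: "finite S" "S \<noteq> {}" using L by (auto simp: S_def)
  have verts: "y \<in> comb_verts H" if "y \<in> S" for y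
    using that i(2) by (fastforce simp: S_def comb_verts_def)
  have path: "\<exists>k w. k \<le> 2 * r \<and> {w 0, w k} = {(0, 0), y} \<and> inj_on w {..k} \<and>
      (\<forall>i<k. w (Suc i) \<in> neighbours (comb H) (w i))" if y: "y \<in> S" for y
  proof -
    obtain j l where j: "j < L" "l \<le> r" "y = (- int (j * b + i j), l)" using y by (auto simp: S_def)
    have "j * b + i j \<le> Suc j * b" using i(1)[OF j(1)] by simp
    also have "\<dots> \<le> r" unfolding r_def using j(1) by (intro mult_le_mono1) simp
    finally have "l + (j * b + i j) \<le> 2 * r" using j(2) by simp
    moreover have "descent y (l + (j * b + i j)) = (0, 0)"
      using descent_spine[of y "j * b + i j"] j(3) by simp
    moreover have "inj_on (descent y) {..l + (j * b + i j)}"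
      by (rule inj_on_subset[OF inj_descent subset_UNIV])
    moreover have "descent y (Suc i) \<in> neighbours (comb H) (descent y i)" for i
      using H verts[OF y] by (rule descent_step)
    ultimately show ?thesis
      by (intro exI[of _ "l + (j * b + i j)"] exI[of _ "descent y"]) auto
  qed
  have nonempty: "neighbours (comb H) y \<noteq> {}" if "y \<in> S" for y
    using descent_step[OF H verts[OF that], of 0] by auto
  have "ret m \<le> 4 / card S + 4 * real (2 * r) / m"
    using m by (intro ret_le_volume[OF S _ nonempty path]) auto
  \<comment> \<open>Here 32 = 4 * 2 * 4: the constant of \<open>ret_le_volume\<close>, the path
    length \<open>2 * r\<close>, and the factor 4 in the bound on \<open>r\<close>.\<close>
  also have "\<dots> \<le> 4 / real m powr (1/2 + \<eta>) + 32 * real m powr (1/2 - \<eta>) / real m"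
  proof (intro add_mono divide_left_mono divide_right_mono)
    have "real m powr (1/2 + \<eta>) = real m powr (2 * \<eta>) * real m powr (1/2 - \<eta>)"
      by (simp add: add.commute flip: powr_add)
    also have "\<dots> \<le> real L * real (Suc r)"
      using bounds(1,4) by (intro mult_mono) auto
    finally show "real m powr (1/2 + \<eta>) \<le> real (card S)" by (simp only: card of_nat_mult)
    show "4 * real (2 * r) \<le> 32 * real m powr (1/2 - \<eta>)" using bounds(5) by simp
    show "0 < real (card S) * real m powr (1/2 + \<eta>)"
      unfolding card of_nat_mult using L m' by (intro mult_pos_pos) auto
  qed auto
  also have "real m powr (1/2 - \<eta>) = real m * real m powr (- 1/2 - \<eta>)"
    using m' by (subst powr_mult_base) auto
  also have "4 / real m powr (1/2 + \<eta>) = 4 * real m powr (- (1/2 + \<eta>))"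
    unfolding powr_minus_divide by simp
  also have "- (1/2 + \<eta>) = - 1/2 - \<eta>" by simp
  finally show ?thesis using m' by simp
qed

text \<open>Every vertex starts an infinite injective descent, whose first \<open>R + 1\<close>
  points, with \<open>R\<close> of order sqrt m, serve in \<open>heat_le_volume\<close>. The bound
  on \<open>ret\<close> keeps \<open>R * ret m\<close> bounded, so the oscillation also has order
  \<open>m powr (- 1/2)\<close>.\<close>

lemma comb_heat_le:
  fixes H :: "int \<Rightarrow> real"
  assumes H: "\<And>x. 0 \<le> H x" and \<eta>: "0 < \<eta>" and m: "1 \<le> m"
    and ret: "rooted_graph.ret (neighbours (comb H)) (0, 0) m \<le> 36 * real m powr (- 1/2 - \<eta>)"
  shows "rooted_graph.heat (neighbours (comb H)) (0, 0) (2 * m) v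
    + rooted_graph.heat (neighbours (comb H)) (0, 0) (Suc (2 * m)) v \<le> 20 * real m powr (- 1/2)"
proof -
  interpret rooted_graph "neighbours (comb H)" "(0, 0)" by (rule rooted_graph_comb[OF H])
  have m': "1 \<le> real m" using m by simp
  show ?thesis
  proof (cases "v \<in> comb_verts H")
    case False
    \<comment> \<open>Pairs outside the comb count as isolated vertices, where the heat kernel is 0
      at positive times.\<close>
    then have "neighbours (comb H) v = {}" by (auto simp: neighbours_comb[OF H])
    then show ?thesis using m by (simp add: heat_isolated del: heat.simps)
  next
    case True
    define R where "R = nat \<lceil>real m powr (1/2)\<rceil>"
    have R: "real m powr (1/2) \<le> real R" "real R \<le> 2 * real m powr (1/2)"
      unfolding R_def using m' by (intro nat_ceiling_bounds ge_one_powr_ge_zero; simp)+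
    define S where "S = descent v ` {..R}"
    have card: "card S = Suc R"
      unfolding S_def by (subst card_image[OF inj_on_subset[OF inj_descent subset_UNIV]]) simp
    have step: "descent v (Suc i) \<in> neighbours (comb H) (descent v i)" for i
      using H True by (rule descent_step)
    have path: "\<exists>k w. k \<le> R \<and> {w 0, w k} = {v, y} \<and> inj_on w {..k} \<and>
        (\<forall>i<k. w (Suc i) \<in> neighbours (comb H) (w i))" if y: "y \<in> S" for y
    proof -
      obtain k where "k \<le> R" "y = descent v k" using y by (auto simp: S_def)
      moreover have "inj_on (descent v) {..k}"
        by (rule inj_on_subset[OF inj_descent subset_UNIV])
      ultimately show ?thesis using step
        by (intro exI[of _ k] exI[of _ "descent v"]) auto
    qed
    have "heat (2 * m) v + heat (Suc (2 * m)) v \<le> 2 / card S + 2 * sqrt (real R * ret m / real m)"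
    proof (rule heat_le_volume)
      show "neighbours (comb H) y \<noteq> {}" if "y \<in> S" for y
        using that step by (auto simp: S_def)
    qed (use m path in \<open>auto simp: S_def\<close>)
    also have "2 / card S \<le> 2 / real m powr (1/2)"
      using R m' by (intro divide_left_mono) (auto simp: card)
    \<comment> \<open>The product is at most 2 * 36 = 72; the square 81 gives the root 9 and the
      final constant 2 + 2 * 9 = 20.\<close>
    also have "real R * ret m / real m \<le> 81 / real m"
    proof (intro divide_right_mono)
      have "real R * ret m \<le> (2 * real m powr (1/2)) * (36 * real m powr (- 1/2 - \<eta>))"
        using R ret ret_nonneg by (intro mult_mono) auto
      also have "\<dots> = 72 * real m powr (1/2 + (- 1/2 - \<eta>))"
        by (simp only: powr_add)
      also have "\<dots> \<le> 72 * 1"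
        using m' \<eta> powr_mono[of "- \<eta>" 0 "real m"] by simp
      finally show "real R * ret m \<le> 81" by simp
    qed simp
    also have "sqrt (81 / real m) = 9 / real m powr (1/2)"
      using m' by (simp add: real_sqrt_divide powr_half_sqrt)
    also have "2 / real m powr (1/2) + 2 * (9 / real m powr (1/2)) = 20 * real m powr (- 1/2)"
      using powr_minus_divide[of "real m" "1/2"] by simp
    finally show ?thesis by simp
  qed
qed

lemma comb_finite_triple_collision:
  fixes H :: "int \<Rightarrow> real"
  assumes H: "\<And>x. 0 \<le> H x" and \<eta>: "0 < \<eta>" "\<eta> < 1/12"
    and tall: "eventually (\<lambda>m. \<forall>j<num_blocks \<eta> m. \<exists>i<block_length \<eta> m.
      real (num_blocks \<eta> m * block_length \<eta> m) < H (- int (j * block_length \<eta> m + i))) sequentially"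
  shows "finite_triple_collision (comb H)"
proof -
  note rg = rooted_graph_comb[of H, OF H]
  interpret rooted_graph "neighbours (comb H)" "(0, 0)" by (rule rg)
  have deg: "deg v \<le> 4" for v
  proof -
    obtain x l where v: "v = (x, l)" by fastforce
    have "card (neighbours (comb H) v) \<le> card {(x - 1, 0), (x + 1, 0), (x, l + 1), (x, l - 1)}"
      unfolding v by (intro card_mono neighbours_comb_subset) auto
    also have "\<dots> \<le> 4" by (simp add: card_insert_if)
    finally show ?thesis by (simp add: deg_def)
  qed
  have "eventually (\<lambda>m. ret m \<le> 36 * real m powr (- 1/2 - \<eta>) \<and>
      (\<forall>v. heat (2 * m) v + heat (Suc (2 * m)) v \<le> 20 * real m powr (- 1/2))) sequentially"
    using tall eventually_ge_at_top[of 1]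
  proof eventually_elim
    case (elim m)
    have "ret m \<le> 36 * real m powr (- 1/2 - \<eta>)"
      by (rule comb_ret_le[of H, OF H \<eta> elim(2,1)])
    then show ?case using comb_heat_le[of H, OF H \<eta>(1) elim(2)] by blast
  qed
  then have "summable (\<lambda>n. \<Sum>v\<in>nball (2 * n). (deg v * heat n v)^3)"
    using deg \<eta>(1) by (intro summable_cubes[of 4 \<eta>])
  then have "AE (X1, X2, X3) in srw_law (comb H) (0, 0) \<Otimes>\<^sub>M (srw_law (comb H) (0, 0) \<Otimes>\<^sub>M srw_law (comb H) (0, 0)).
      finite {n. X1 n = X2 n \<and> X2 n = X3 n}"
    by (rule AE_finite_triple_collisions[OF rg])
  moreover have "(0, 0) \<in> pverts (comb H)"
    using H by (simp add: comb_def comb_verts_def)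
  ultimately show ?thesis
    unfolding finite_triple_collision_def using comb_graph[of H, OF H] by blast
qed

theorem corollary5p2:
  fixes P :: "'w measure" and H :: "int \<Rightarrow> 'w \<Rightarrow> real" and \<gamma> C :: real
  assumes "0 < \<gamma>" and "\<gamma> < 1" and "0 < C"
    and "prob_space P"
    and "\<And>x \<omega>. \<omega> \<in> space P \<Longrightarrow> 0 \<le> H x \<omega>"
    and "prob_space.indep_vars P (\<lambda>_. borel) H UNIV"
    and "\<And>x. distr P borel (H x) = distr P borel (H 0)"
    and "((\<lambda>z. z powr \<gamma> * measure P {\<omega> \<in> space P. H 0 \<omega> > z}) \<longlongrightarrow> C) at_top"
  shows "AE \<omega> in P. finite_triple_collision (comb (\<lambda>x. H x \<omega>))"
proof -
  interpret prob_space P by fact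
  define \<eta> where "\<eta> = (1 - \<gamma>) / 12"
  have \<eta>: "0 < \<eta>" "\<eta> < 1/12" using assms(1,2) by (auto simp: \<eta>_def)
  from AE_tall_teeth[OF assms(1-3,6-8) \<eta>_def] show ?thesis
  proof (rule AE_mp, intro AE_I2 impI)
    fix \<omega> assume "\<omega> \<in> space P" and tall: "eventually (\<lambda>m. \<forall>j<num_blocks \<eta> m. \<exists>i<block_length \<eta> m.
      real (num_blocks \<eta> m * block_length \<eta> m) < H (- int (j * block_length \<eta> m + i)) \<omega>) sequentially"
    then show "finite_triple_collision (comb (\<lambda>x. H x \<omega>))"
      using assms(5) by (intro comb_finite_triple_collision[OF _ \<eta> tall])
  qed
qed

end
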